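(* Let $\operatorname{br}(\pi)$ and $\operatorname{udr}(\pi)$ be the number of biruns and the number of up-down runs of $\pi$, and let $v=\sqrt{1-t^2}$. Then $$\sum_{n\ge0}\sum_{\pi\in\mathfrak S_n}t^{\operatorname{br}(\pi)}\frac{x^n}{n!}=\frac{v}{(1+t)^2}\cdot\frac{2t+(1+x+t^2(1-x))\cosh(vx)-v(1+x)\sinh(vx)}{v\cosh(vx)-\sinh(vx)}$$ and $$\sum_{n\ge0}\sum_{\pi\in\mathfrak S_n}t^{\operatorname{udr}(\pi)}\frac{x^n}{n!}=\frac{v}{1+t}\cdot\frac{t+\cosh(vx)-v\sinh(vx)}{v\cosh(vx)-\sinh(vx)}.$$
   Context: $\mathfrak S_n$ is the set of permutations of $[n]$. A birun of $\pi=\pi_1\cdots\pi_n$ is a maximal consecutive subsequence of length at least two that is increasing, or a maximal consecutive subsequence of length at least two that is decreasing (e.g. the biruns of $51378624$ are $51,1378,862,24$). An increasing run of $\pi$ is a maximal increasing consecutive subsequence; an up-down run is either a birun or the initial increasing run when it has length $1$ (e.g. the up-down runs of $51378624$ are $5,51,1378,862,24$). Right-hand sides are formal power series in $x$ depending on $v$ only through $v^2$ where appropriate. *)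

theory Defs
  imports
    "HOL-Library.Sublist"
    "HOL-Combinatorics.Multiset_Permutations"
    "HOL-Computational_Algebra.Formal_Laurent_Series"
begin

text \<open>
  A permutation of \<open>[n]\<close> is the list of its values (one-line notation), that is, an element of
  \<^term>\<open>permutations_of_set {1..n}\<close>. As its letters are distinct, a nonempty consecutive
  subsequence occurs at a single position, so runs may be counted as a set of lists.
\<close>

definition maximal_sublist :: "('a list \<Rightarrow> bool) \<Rightarrow> 'a list \<Rightarrow> 'a list \<Rightarrow> bool" where
  "maximal_sublist P ys xs \<longleftrightarrow>
     sublist ys xs \<and> P ys \<and> (\<forall>zs. sublist zs xs \<and> P zs \<and> sublist ys zs \<longrightarrow> zs = ys)"

abbreviation increasing :: "nat list \<Rightarrow> bool" where
  "increasing \<equiv> sorted_wrt (<)"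

abbreviation decreasing :: "nat list \<Rightarrow> bool" where
  "decreasing \<equiv> sorted_wrt (>)"

definition biruns :: "nat list \<Rightarrow> nat list set" where
  "biruns \<pi> = {ys. 2 \<le> length ys \<and>
     (maximal_sublist increasing ys \<pi> \<or> maximal_sublist decreasing ys \<pi>)}"

text \<open>Runs are nonempty; this matters only for the empty permutation, which has none.\<close>

definition increasing_runs :: "nat list \<Rightarrow> nat list set" where
  "increasing_runs \<pi> = {ys. ys \<noteq> [] \<and> maximal_sublist increasing ys \<pi>}"

definition up_down_runs :: "nat list \<Rightarrow> nat list set" where
  "up_down_runs \<pi> = biruns \<pi> \<union> {ys \<in> increasing_runs \<pi>. prefix ys \<pi> \<and> length ys = 1}"

definition br :: "nat list \<Rightarrow> nat" where
  "br \<pi> = card (biruns \<pi>)"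

definition udr :: "nat list \<Rightarrow> nat" where
  "udr \<pi> = card (up_down_runs \<pi>)"

definition perm_egf :: "(nat list \<Rightarrow> nat) \<Rightarrow> 'a::field_char_0 \<Rightarrow> 'a fps" where
  "perm_egf st t = Abs_fps (\<lambda>n. (\<Sum>\<pi>\<in>permutations_of_set {1..n}. t ^ st \<pi>) / fact n)"

definition fps_cosh :: "'a::field_char_0 \<Rightarrow> 'a fps" where
  "fps_cosh c = fps_const (1 / 2) * (fps_exp c + fps_exp (- c))"

definition fps_sinh :: "'a::field_char_0 \<Rightarrow> 'a fps" where
  "fps_sinh c = fps_const (1 / 2) * (fps_exp c - fps_exp (- c))"

text \<open>
  \<open>t\<close> may be any element of a field of characteristic 0 with a nonzero square root \<open>v\<close> of
  \<open>1 - t\<^sup>2\<close> in that field (so \<open>t \<noteq> 1\<close> and \<open>t \<noteq> -1\<close>). An indeterminate \<open>t\<close> is the case of the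
  field \<^typ>\<open>rat fls\<close>, \<open>t\<close> being \<^term>\<open>fls_X\<close>, which has such a root:
\<close>

lemma sqrt_one_minus_indeterminate_square:
  "\<exists>v::'a::field_char_0 fls. v\<^sup>2 = 1 - fls_X\<^sup>2 \<and> v \<noteq> 0"
proof -
  define w :: "'a fps" where "w = fps_binomial (1 / 2) oo (- (fps_X\<^sup>2))"
  have "w * w = (fps_binomial (1 / 2) * fps_binomial (1 / 2)) oo (- (fps_X\<^sup>2))"
    unfolding w_def by (subst fps_compose_mult_distrib) auto
  also have "fps_binomial (1 / 2) * fps_binomial (1 / 2) = (1 + fps_X :: 'a fps)"
    by (simp add: fps_binomial_add_mult [symmetric] fps_binomial_1)
  also have "(1 + fps_X :: 'a fps) oo (- (fps_X\<^sup>2)) = 1 - fps_X\<^sup>2"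
    by (simp add: fps_compose_add_distrib)
  finally have "w\<^sup>2 = 1 - fps_X\<^sup>2"
    by (simp add: power2_eq_square)
  then have sq: "(fps_to_fls w)\<^sup>2 = 1 - fls_X\<^sup>2"
    by (simp add: fps_to_fls_power flip: fps_to_fls_power [of w])
  have "w \<noteq> 0"
  proof
    assume "w = 0"
    then have "fps_nth (1 - fps_X\<^sup>2 :: 'a fps) 0 = 0"
      using \<open>w\<^sup>2 = 1 - fps_X\<^sup>2\<close> by (metis fps_zero_nth zero_power2)
    then show False
      by simp
  qed
  with sq show ?thesis
    by (intro exI [of _ "fps_to_fls w"]) simp
qed

end

theory Submission
  imports Defs
begin

text \<open>
  In the word of ascents and descents of \<open>\<pi>\<close>, the biruns are the maximal constant blocks; for the
  up-down runs one first prepends an ascent. Write \<open>\<pi> = \<sigma> m \<tau>\<close> with \<open>m\<close> the largest letter: as the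
  letter before \<open>m\<close> is an ascent and the letter after it a descent, the number of blocks is additive.
  Let \<open>B\<close> and \<open>U\<close> be the two generating functions, and let \<open>V\<close> and \<open>W\<close> be those of the blocks of
  the words extended by an ascent on the left and by an ascent (for \<open>V\<close>) or a descent (for \<open>W\<close>) on
  the right. With the complement and reversal symmetries, additivity becomes
  \<open>B' = U\<^sup>2\<close>, \<open>U' = V U\<close>, \<open>V' = V W\<close>, \<open>W' = V\<^sup>2\<close>. Hence \<open>W\<^sup>2 - V\<^sup>2\<close> is constant, namely \<open>v\<^sup>2\<close>, and the
  Riccati equation \<open>W' = W\<^sup>2 - v\<^sup>2\<close> is solved by \<open>W = - D' / D\<close> with \<open>D = v cosh (v x) - sinh (v x)\<close>.
  The remaining functions follow from linear differential equations.
\<close>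

subsection \<open>Sums over permutations\<close>

text \<open>Only the relative order of the letters matters, so such a statistic may be evaluated on
  words over any finite set of letters.\<close>

definition order_invariant :: "(nat list \<Rightarrow> 'b) \<Rightarrow> bool" where
  "order_invariant st \<longleftrightarrow>
     (\<forall>xs e. strict_mono_on (set xs) e \<longrightarrow> st (map e xs) = st xs)"

lemma sum_permutations_of_set_image:
  assumes "inj_on e A"
  shows "(\<Sum>\<pi>\<in>permutations_of_set (e ` A). f \<pi>) = (\<Sum>\<pi>\<in>permutations_of_set A. f (map e \<pi>))"
proof -
  have "inj_on (map e) (permutations_of_set A)"
    using assms by (intro inj_onI) (auto simp: permutations_of_set_def inj_on_map_eq_map)
  then show ?thesis
    by (simp add: permutations_of_set_image_inj[OF assms] sum.reindex)
qed

text \<open>Standardization: the increasing bijection from an initial segment onto \<open>A\<close>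
  transports the sum.\<close>

lemma sum_permutations_order_invariant:
  fixes st :: "nat list \<Rightarrow> 'a::comm_monoid_add"
  assumes "order_invariant st" "finite A"
  shows "(\<Sum>\<pi>\<in>permutations_of_set A. st \<pi>) = (\<Sum>\<pi>\<in>permutations_of_set {1..card A}. st \<pi>)"
proof -
  obtain h where h: "bij_betw h {..<card A} A" "strict_mono_on {..<card A} h"
    using ex_bij_betw_strict_mono_card[OF assms(2)] by blast
  \<comment> \<open>\<open>h\<close> is indexed from 0, while permutations of [n] start at 1; hence
    the shift.\<close>
  define e where "e = (\<lambda>i. h (i - 1))"
  have img: "e ` {1..card A} = A"
  proof -
    have "(\<lambda>i. i - 1) ` {1..card A} = {..<card A}"
      by (force simp: image_iff intro: bexI[of _ "Suc _"])
    then have "h ` (\<lambda>i. i - 1) ` {1..card A} = A"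
      using h(1) by (simp add: bij_betw_def)
    then show ?thesis
      by (simp only: image_image e_def)
  qed
  have mono: "strict_mono_on {1..card A} e"
  proof (rule strict_mono_onI)
    fix r s assume "r \<in> {1..card A}" "s \<in> {1..card A}" "r < s"
    then show "e r < e s"
      unfolding e_def by (intro strict_mono_onD[OF h(2)]) auto
  qed
  have "(\<Sum>\<pi>\<in>permutations_of_set A. st \<pi>) = (\<Sum>\<pi>\<in>permutations_of_set {1..card A}. st (map e \<pi>))"
    using sum_permutations_of_set_image[OF strict_mono_on_imp_inj_on[OF mono], of st] img by simp
  also have "\<dots> = (\<Sum>\<pi>\<in>permutations_of_set {1..card A}. st \<pi>)"
    using assms(1) mono
    by (intro sum.cong refl) (auto simp: order_invariant_def permutations_of_set_def)
  finally show ?thesis .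
qed

text \<open>Cutting a permutation at its unique occurrence of \<open>m\<close>; \<open>B\<close> is
  the set of letters to the left of \<open>m\<close>.\<close>

lemma sum_permutations_insert:
  assumes "finite A" "m \<notin> A"
  shows "(\<Sum>\<pi>\<in>permutations_of_set (insert m A). f \<pi>) =
    (\<Sum>B\<in>Pow A. \<Sum>\<sigma>\<in>permutations_of_set B. \<Sum>\<tau>\<in>permutations_of_set (A - B). f (\<sigma> @ m # \<tau>))"
proof -
  let ?S = "SIGMA B:Pow A. permutations_of_set B \<times> permutations_of_set (A - B)"
  have "(\<Sum>\<pi>\<in>permutations_of_set (insert m A). f \<pi>) = (\<Sum>(B, \<sigma>, \<tau>)\<in>?S. f (\<sigma> @ m # \<tau>))"
  proof -
    have "bij_betw (\<lambda>(B, \<sigma>, \<tau>). \<sigma> @ m # \<tau>) ?S (permutations_of_set (insert m A))"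
      unfolding bij_betw_def
    proof (intro conjI equalityI subsetI)
      show "inj_on (\<lambda>(B, \<sigma>, \<tau>). \<sigma> @ m # \<tau>) ?S"
      proof (rule inj_onI)
        fix p q
        assume p: "p \<in> ?S" and q: "q \<in> ?S"
          and eq: "(case p of (B, \<sigma>, \<tau>) \<Rightarrow> \<sigma> @ m # \<tau>) = (case q of (B, \<sigma>, \<tau>) \<Rightarrow> \<sigma> @ m # \<tau>)"
        obtain B \<sigma> \<tau> B' \<sigma>' \<tau>' where pq: "p = (B, \<sigma>, \<tau>)" "q = (B', \<sigma>', \<tau>')"
          by (metis prod_cases3)
        have "m \<notin> set \<sigma>" "m \<notin> set \<tau>"
          using p assms(2) by (auto simp: pq permutations_of_set_def)
        with eq have "\<sigma> = \<sigma>' \<and> \<tau> = \<tau>'"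
          by (simp add: pq append_Cons_eq_iff)
        with p q show "p = q"
          by (simp add: pq permutations_of_set_def)
      qed
    next
      fix \<pi> assume "\<pi> \<in> (\<lambda>(B, \<sigma>, \<tau>). \<sigma> @ m # \<tau>) ` ?S"
      then show "\<pi> \<in> permutations_of_set (insert m A)"
        using assms(2) by (auto simp: permutations_of_set_def)
    next
      fix \<pi> assume \<pi>: "\<pi> \<in> permutations_of_set (insert m A)"
      then obtain \<sigma> \<tau> where eq: "\<pi> = \<sigma> @ m # \<tau>"
        using split_list[of m \<pi>] by (auto simp: permutations_of_set_def)
      with \<pi> assms(2) have "(set \<sigma>, \<sigma>, \<tau>) \<in> ?S"
        by (auto simp: permutations_of_set_def)
      with eq show "\<pi> \<in> (\<lambda>(B, \<sigma>, \<tau>). \<sigma> @ m # \<tau>) ` ?S"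
        by (intro image_eqI[of _ _ "(set \<sigma>, \<sigma>, \<tau>)"]) auto
    qed
    from sum.reindex_bij_betw[OF this, of f] show ?thesis
      by (simp add: case_prod_unfold)
  qed
  also have "\<dots> = (\<Sum>B\<in>Pow A. \<Sum>(\<sigma>, \<tau>)\<in>permutations_of_set B \<times> permutations_of_set (A - B).
      f (\<sigma> @ m # \<tau>))"
    using assms(1) finite_subset[of _ A] by (subst sum.Sigma) auto
  finally show ?thesis
    by (simp add: sum.cartesian_product)
qed

lemma sum_Pow_card:
  fixes f :: "nat \<Rightarrow> 'a::comm_semiring_1"
  assumes "finite A"
  shows "(\<Sum>B\<in>Pow A. f (card B)) = (\<Sum>k\<le>card A. of_nat (card A choose k) * f k)"
proof -
  have "(\<Sum>B\<in>Pow A. f (card B)) = (\<Sum>k\<le>card A. \<Sum>B\<in>{B \<in> Pow A. card B = k}. f (card B))"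
    using assms by (intro sum.group[symmetric]) (auto simp: card_mono)
  also have "\<dots> = (\<Sum>k\<le>card A. of_nat (card A choose k) * f k)"
    using n_subsets[OF assms] by (intro sum.cong refl) (simp add: Pow_def)
  finally show ?thesis .
qed

lemma order_invariant_compose: "order_invariant st \<Longrightarrow> order_invariant (\<lambda>\<pi>. f (st \<pi>))"
  unfolding order_invariant_def by metis

text \<open>The product rule for exponential generating functions. Differentiation removes the
  largest letter \<open>Suc n\<close>; the remaining letters are distributed to its two sides, and
  additivity of the exponent makes the weight multiplicative.\<close>

lemma fps_deriv_perm_egf:
  fixes t :: "'a::field_char_0"
  assumes inv: "order_invariant st1" "order_invariant st2"
    and split: "\<And>\<sigma> m \<tau>. distinct (\<sigma> @ m # \<tau>) \<Longrightarrow> \<forall>x\<in>set (\<sigma> @ \<tau>). x < m \<Longrightarrow>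
      st (\<sigma> @ m # \<tau>) = st1 \<sigma> + st2 \<tau>"
  shows "fps_deriv (perm_egf st t) = perm_egf st1 t * perm_egf st2 t"
proof (rule fps_ext)
  fix n :: nat
  define G where "G s k = (\<Sum>\<pi>\<in>permutations_of_set {1..k}. t ^ s \<pi>)"
    for s :: "nat list \<Rightarrow> nat" and k :: nat
  let ?A = "{1..n}"
  have sums: "(\<Sum>\<pi>\<in>permutations_of_set B. t ^ s \<pi>) = G s (card B)"
    if "order_invariant s" "finite B" for s B
    unfolding G_def
    using sum_permutations_order_invariant[OF order_invariant_compose[OF that(1), of "(^) t"] that(2)] .
  have "G st (Suc n) = (\<Sum>B\<in>Pow ?A. \<Sum>\<sigma>\<in>permutations_of_set B.
      \<Sum>\<tau>\<in>permutations_of_set (?A - B). t ^ st (\<sigma> @ Suc n # \<tau>))"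
    unfolding G_def by (subst sum_permutations_insert[symmetric]) (auto simp: atLeastAtMostSuc_conv)
  also have "\<dots> = (\<Sum>B\<in>Pow ?A. \<Sum>\<sigma>\<in>permutations_of_set B.
      \<Sum>\<tau>\<in>permutations_of_set (?A - B). t ^ st1 \<sigma> * t ^ st2 \<tau>)"
  proof (intro sum.cong refl)
    fix B \<sigma> \<tau>
    assume "B \<in> Pow ?A" "\<sigma> \<in> permutations_of_set B" "\<tau> \<in> permutations_of_set (?A - B)"
    then have "st (\<sigma> @ Suc n # \<tau>) = st1 \<sigma> + st2 \<tau>"
      by (intro split) (auto simp: permutations_of_set_def)
    then show "t ^ st (\<sigma> @ Suc n # \<tau>) = t ^ st1 \<sigma> * t ^ st2 \<tau>"
      by (simp add: power_add)
  qed
  also have "\<dots> = (\<Sum>B\<in>Pow ?A. G st1 (card B) * G st2 (n - card B))"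
  proof (intro sum.cong refl)
    fix B assume B: "B \<in> Pow ?A"
    then have fin: "finite B" "finite (?A - B)" by (auto intro: finite_subset)
    with B have "card (?A - B) = n - card B" by (simp add: card_Diff_subset)
    with fin show "(\<Sum>\<sigma>\<in>permutations_of_set B. \<Sum>\<tau>\<in>permutations_of_set (?A - B).
        t ^ st1 \<sigma> * t ^ st2 \<tau>) = G st1 (card B) * G st2 (n - card B)"
      by (simp only: sum_product[symmetric] sums[OF inv(1)] sums[OF inv(2)])
  qed
  also have "\<dots> = (\<Sum>k\<le>n. of_nat (n choose k) * (G st1 k * G st2 (n - k)))"
    by (subst sum_Pow_card) auto
  \<comment> \<open>The binomial coefficient supplies the factorials that normalize both
    factors.\<close>
  also have "\<dots> = fact n * (\<Sum>k\<le>n. (G st1 k / fact k) * (G st2 (n - k) / fact (n - k)))"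
    unfolding sum_distrib_left
    by (intro sum.cong refl) (simp add: binomial_fact field_simps)
  finally have "G st (Suc n) / fact n
      = (\<Sum>k\<le>n. (G st1 k / fact k) * (G st2 (n - k) / fact (n - k)))"
    by (simp add: field_simps)
  moreover have "fps_nth (fps_deriv (perm_egf st t)) n = G st (Suc n) / fact n"
    by (simp add: perm_egf_def G_def del: of_nat_Suc)
  ultimately show "fps_nth (fps_deriv (perm_egf st t)) n
      = fps_nth (perm_egf st1 t * perm_egf st2 t) n"
    by (simp add: fps_mult_nth perm_egf_def G_def atLeast0AtMost)
qed

section \<open>Symmetries of the generating functions\<close>

lemma perm_egf_cong:
  assumes "\<And>\<pi>. distinct \<pi> \<Longrightarrow> \<forall>x\<in>set \<pi>. 0 < x \<Longrightarrow> st \<pi> = st' \<pi>"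
  shows "perm_egf st t = perm_egf st' t"
  unfolding perm_egf_def
  by (intro arg_cong[of _ _ Abs_fps] ext arg_cong2[of _ _ _ _ "(/)"] refl sum.cong
      arg_cong2[of _ _ _ _ "(^)"] assms) (auto simp: permutations_of_set_def)

lemma perm_egf_rev: "perm_egf (\<lambda>\<pi>. st (rev \<pi>)) t = perm_egf st t"
proof -
  have "(\<Sum>\<pi>\<in>permutations_of_set A. t ^ st (rev \<pi>)) = (\<Sum>\<pi>\<in>permutations_of_set A. t ^ st \<pi>)"
    for A :: "nat set"
    by (rule sum.reindex_bij_witness[of _ rev rev]) (auto simp: permutations_of_set_def)
  then show ?thesis by (simp add: perm_egf_def)
qed

text \<open>The witness is the complement, which replaces i by n + 1 - i: it reverses the order and
  permutes [n].\<close>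

lemma perm_egf_complement:
  assumes "\<And>\<pi> e. distinct \<pi> \<Longrightarrow> strict_antimono_on (set \<pi>) e \<Longrightarrow> st' (map e \<pi>) = st \<pi>"
  shows "perm_egf st' t = perm_egf st t"
proof -
  have "(\<Sum>\<pi>\<in>permutations_of_set {1..n}. t ^ st' \<pi>) = (\<Sum>\<pi>\<in>permutations_of_set {1..n}. t ^ st \<pi>)" for n
  proof -
    let ?e = "\<lambda>i. Suc n - i"
    have img: "?e ` {1..n} = {1..n}"
      proof (intro equalityI subsetI)
      fix i assume "i \<in> {1..n}"
      then show "i \<in> ?e ` {1..n}" by (intro image_eqI[of _ _ "Suc n - i"]) auto
    qed auto
    have "inj_on ?e {1..n}" by (auto simp: inj_on_def)
    then have "(\<Sum>\<pi>\<in>permutations_of_set {1..n}. t ^ st' \<pi>)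
        = (\<Sum>\<pi>\<in>permutations_of_set {1..n}. t ^ st' (map ?e \<pi>))"
      using sum_permutations_of_set_image[of ?e "{1..n}" "\<lambda>\<pi>. t ^ st' \<pi>"] img by simp
    also have "\<dots> = (\<Sum>\<pi>\<in>permutations_of_set {1..n}. t ^ st \<pi>)"
    proof (intro sum.cong refl arg_cong2[of _ _ _ _ "(^)"])
      fix \<pi> assume "\<pi> \<in> permutations_of_set {1..n}"
      then show "st' (map ?e \<pi>) = st \<pi>"
        by (intro assms monotone_onI) (auto simp: permutations_of_set_def)
    qed
    finally show ?thesis .
  qed
  then show ?thesis by (simp add: perm_egf_def)
qed

subsection \<open>Blocks of the ascent word\<close>

fun ascents :: "nat list \<Rightarrow> bool list" where
  "ascents (a # b # xs) = (a < b) # ascents (b # xs)"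
| "ascents _ = []"

abbreviation blocks :: "bool list \<Rightarrow> nat" where
  "blocks w \<equiv> length (remdups_adj w)"

text \<open>The letter \<open>y\<close> belongs to both pieces, because it is compared with its
  neighbours on both sides.\<close>

lemma ascents_append: "ascents (xs @ y # ys) = ascents (xs @ [y]) @ ascents (y # ys)"
  by (induction xs rule: ascents.induct) auto

lemma ascents_mono_map:
  "strict_mono_on (set xs) e \<Longrightarrow> ascents (map e xs) = ascents xs"
proof (induction xs rule: ascents.induct)
  case (1 a b xs)
  moreover from this have "strict_mono_on (set (b # xs)) e"
    by (auto intro: monotone_on_subset)
  ultimately show ?case
    by (simp add: strict_mono_on_less)
qed auto

lemma ascents_antimono_map:
  "distinct xs \<Longrightarrow> strict_antimono_on (set xs) e \<Longrightarrow> ascents (map e xs) = map Not (ascents xs)"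
proof (induction xs rule: ascents.induct)
  case (1 a b xs)
  then have "strict_antimono_on (set (b # xs)) e"
    by (auto intro: monotone_on_subset)
  moreover have "e a < e b \<longleftrightarrow> \<not> a < b"
    using "1.prems" by (auto simp: monotone_on_def not_less dest: order.asym le_neq_implies_less)
  ultimately show ?case
    using 1 by simp
qed auto

lemma ascents_rev: "distinct xs \<Longrightarrow> ascents (rev xs) = map Not (rev (ascents xs))"
  by (induction xs rule: ascents.induct)
     (auto simp: ascents_append[of _ _ "[_]"])

lemma ascents_snoc_max:
  "\<forall>x\<in>set xs. x < m \<Longrightarrow> ascents (xs @ [m]) = (if xs = [] then [] else ascents xs @ [True])"
  by (induction xs rule: ascents.induct) auto

lemma ascents_Cons_max:
  "\<forall>x\<in>set xs. x < m \<Longrightarrow> ascents (m # xs) = (if xs = [] then [] else False # ascents xs)"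
  by (cases xs) auto

lemma blocks_map_Not: "blocks (map Not w) = blocks w"
  by (simp add: remdups_adj_map_injective inj_def)

lemma blocks_append:
  "u = [] \<or> w = [] \<or> last u \<noteq> hd w \<Longrightarrow> blocks (u @ w) = blocks u + blocks w"
  by (simp add: remdups_adj_append')

text \<open>
  The letter \<open>p\<close> (\<open>q\<close>) records the comparison of the first (last) entry of \<open>\<pi>\<close> with a neighbour
  that is smaller or larger than all entries of \<open>\<pi>\<close>. Two opposite letters around the empty word stand
  for one and the same neighbour twice, so that there is no comparison at all.
\<close>

definition blocks_left :: "bool \<Rightarrow> nat list \<Rightarrow> nat" where
  "blocks_left p \<pi> = (if \<pi> = [] then 0 else blocks (p # ascents \<pi>))"

definition blocks_right :: "bool \<Rightarrow> nat list \<Rightarrow> nat" where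
  "blocks_right q \<pi> = (if \<pi> = [] then 0 else blocks (ascents \<pi> @ [q]))"

definition blocks_both :: "bool \<Rightarrow> bool \<Rightarrow> nat list \<Rightarrow> nat" where
  "blocks_both p q \<pi> =
     (if \<pi> = [] then (if p = q then 1 else 0) else blocks (p # ascents \<pi> @ [q]))"

lemma order_invariant_blocks:
  "order_invariant (blocks_left p)" "order_invariant (blocks_right p)"
  "order_invariant (blocks_both p q)"
  by (simp_all add: order_invariant_def blocks_left_def blocks_right_def blocks_both_def
      ascents_mono_map)

section \<open>Cutting the ascent word at the largest letter\<close>

lemma ascents_insert_max:
  assumes "\<forall>x\<in>set (\<sigma> @ \<tau>). x < m"
  shows "ascents (\<sigma> @ m # \<tau>) = (if \<sigma> = [] then [] else ascents \<sigma> @ [True]) @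
    (if \<tau> = [] then [] else False # ascents \<tau>)"
  using assms by (subst ascents_append) (simp add: ascents_snoc_max ascents_Cons_max)

text \<open>An ascent leads into \<open>m\<close> and a descent leaves it, so no block extends
  across \<open>m\<close>.\<close>

lemma blocks_insert_max:
  assumes "\<forall>x\<in>set (\<sigma> @ \<tau>). x < m"
  shows "blocks (ascents (\<sigma> @ m # \<tau>)) = blocks_right True \<sigma> + blocks_left False \<tau>"
    and "blocks_left True (\<sigma> @ m # \<tau>) = blocks_both True True \<sigma> + blocks_left False \<tau>"
    and "blocks_both True q (\<sigma> @ m # \<tau>) = blocks_both True True \<sigma> + blocks_both False q \<tau>"
proof -
  let ?u = "if \<sigma> = [] then [] else ascents \<sigma> @ [True]"
  let ?w = "if \<tau> = [] then [] else False # ascents \<tau>"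
  have eq: "ascents (\<sigma> @ m # \<tau>) = ?u @ ?w"
    using assms by (rule ascents_insert_max)
  have "blocks (?u @ ?w) = blocks ?u + blocks ?w"
    by (rule blocks_append) auto
  then show "blocks (ascents (\<sigma> @ m # \<tau>)) = blocks_right True \<sigma> + blocks_left False \<tau>"
    unfolding eq by (simp add: blocks_right_def blocks_left_def)
  have "blocks ((True # ?u) @ ?w) = blocks (True # ?u) + blocks ?w"
    by (rule blocks_append) auto
  then show "blocks_left True (\<sigma> @ m # \<tau>) = blocks_both True True \<sigma> + blocks_left False \<tau>"
    using eq by (simp add: blocks_both_def blocks_left_def)
  \<comment> \<open>If \<tau> is empty and \<open>q\<close> is an ascent, then \<open>q\<close> only
    prolongs the block that ends at \<open>m\<close>. It contributes nothing, in accordance with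
    \<open>blocks_both False True [] = 0\<close>.\<close>
  let ?w' = "if \<tau> = [] then if q then [] else [False] else False # ascents \<tau> @ [q]"
  have "blocks ((True # ?u) @ ?w') = blocks (True # ?u) + blocks ?w'"
    by (rule blocks_append) auto
  moreover have "blocks (True # ascents (\<sigma> @ m # \<tau>) @ [q]) = blocks ((True # ?u) @ ?w')"
    unfolding eq using remdups_adj_append_two[of "True # ascents \<sigma>" True True] by simp
  ultimately show "blocks_both True q (\<sigma> @ m # \<tau>) = blocks_both True True \<sigma> + blocks_both False q \<tau>"
    by (simp add: blocks_both_def)
qed

text \<open>Complementing a permutation flips every letter of its extended ascent word and keeps the
  blocks.\<close>

lemma perm_egf_blocks_complement:
  "perm_egf (blocks_left (\<not> p)) t = perm_egf (blocks_left p) t"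
  "perm_egf (blocks_both (\<not> p) (\<not> q)) t = perm_egf (blocks_both p q) t"
proof -
  show "perm_egf (blocks_left (\<not> p)) t = perm_egf (blocks_left p) t"
    using blocks_map_Not[of "p # ascents _"]
    by (intro perm_egf_complement) (simp add: blocks_left_def ascents_antimono_map)
  show "perm_egf (blocks_both (\<not> p) (\<not> q)) t = perm_egf (blocks_both p q) t"
    using blocks_map_Not[of "p # ascents _ @ [q]"]
    by (intro perm_egf_complement) (simp add: blocks_both_def ascents_antimono_map)
qed

text \<open>Reversal turns the ascent word around and flips its letters, so a final \<open>p\<close>
  becomes an initial \<open>\<not> p\<close>; the complement symmetry restores
  \<open>p\<close>.\<close>

lemma perm_egf_blocks_rev: "perm_egf (blocks_right p) t = perm_egf (blocks_left p) t"
proof -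
  have "perm_egf (blocks_right p) t = perm_egf (\<lambda>\<pi>. blocks_left (\<not> p) (rev \<pi>)) t"
  proof (rule perm_egf_cong)
    fix \<pi> :: "nat list" assume "distinct \<pi>"
    then have "(\<not> p) # ascents (rev \<pi>) = map Not (rev (ascents \<pi> @ [p]))"
      by (simp add: ascents_rev)
    then have "blocks ((\<not> p) # ascents (rev \<pi>)) = blocks (ascents \<pi> @ [p])"
      by (metis blocks_map_Not length_rev remdups_adj_rev)
    then show "blocks_right p \<pi> = blocks_left (\<not> p) (rev \<pi>)"
      by (simp add: blocks_left_def blocks_right_def)
  qed
  then show ?thesis
    by (simp add: perm_egf_rev perm_egf_blocks_complement)
qed

lemma perm_egf_nth_0: "fps_nth (perm_egf st t) 0 = t ^ st []"
  by (simp add: perm_egf_def)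

subsection \<open>Runs as maximal chains\<close>

text \<open>A general relation treats increasing and decreasing runs together.\<close>

definition maximal_chains :: "('a \<Rightarrow> 'a \<Rightarrow> bool) \<Rightarrow> 'a list \<Rightarrow> 'a list set" where
  "maximal_chains R xs = {ys. ys \<noteq> [] \<and> maximal_sublist (sorted_wrt R) ys xs}"

text \<open>Local form of maximality: neither neighbouring letter can be added to the chain.\<close>

definition chain_between :: "('a \<Rightarrow> 'a \<Rightarrow> bool) \<Rightarrow> 'a list \<Rightarrow> 'a list \<Rightarrow> 'a list \<Rightarrow> bool" where
  "chain_between R us ys vs \<longleftrightarrow> ys \<noteq> [] \<and> sorted_wrt R ys \<and>
     (us = [] \<or> \<not> R (last us) (hd ys)) \<and> (vs = [] \<or> \<not> R (last ys) (hd vs))"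

fun first_chain :: "('a \<Rightarrow> 'a \<Rightarrow> bool) \<Rightarrow> 'a list \<Rightarrow> 'a list" where
  "first_chain R (a # b # xs) = (if R a b then a # first_chain R (b # xs) else [a])"
| "first_chain R xs = xs"

lemma sorted_wrt_Cons_hd:
  "transp R \<Longrightarrow> ys \<noteq> [] \<Longrightarrow> sorted_wrt R (x # ys) \<longleftrightarrow> R x (hd ys) \<and> sorted_wrt R ys"
  by (cases ys) (auto dest: transpD)

lemma sorted_wrt_snoc_last:
  "transp R \<Longrightarrow> ys \<noteq> [] \<Longrightarrow> sorted_wrt R (ys @ [x]) \<longleftrightarrow> R (last ys) x \<and> sorted_wrt R ys"
  by (cases ys rule: rev_cases) (auto simp: sorted_wrt_append dest: transpD)

text \<open>A maximal chain cannot be extended by a single neighbour. Conversely, as the letters are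
  distinct, a chain that contains \<open>ys\<close> sits around the same occurrence of
  \<open>ys\<close>, and being larger it would include a neighbour.\<close>

lemma in_maximal_chains_iff:
  assumes "transp R" "distinct xs"
  shows "ys \<in> maximal_chains R xs \<longleftrightarrow> (\<exists>us vs. xs = us @ ys @ vs \<and> chain_between R us ys vs)"
proof
  assume "ys \<in> maximal_chains R xs"
  then have ys: "ys \<noteq> []" "sorted_wrt R ys" "sublist ys xs"
    and max: "\<And>zs. sublist zs xs \<Longrightarrow> sorted_wrt R zs \<Longrightarrow> sublist ys zs \<Longrightarrow> zs = ys"
    by (auto simp: maximal_chains_def maximal_sublist_def)
  then obtain us vs where xs: "xs = us @ ys @ vs"
    by (auto simp: sublist_def)
  have "\<not> R (last us) (hd ys)" if "us \<noteq> []"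
  proof
    assume "R (last us) (hd ys)"
    moreover have "sublist (last us # ys) xs"
      unfolding xs sublist_def using that
      by (cases us rule: rev_cases) auto
    moreover have "sublist ys (last us # ys)"
      by (simp add: sublist_Cons_right)
    ultimately show False
      using max[of "last us # ys"] ys assms(1) by (simp add: sorted_wrt_Cons_hd del: sorted_wrt.simps)
  qed
  moreover have "\<not> R (last ys) (hd vs)" if "vs \<noteq> []"
  proof
    assume "R (last ys) (hd vs)"
    moreover have "sublist (ys @ [hd vs]) xs"
      unfolding xs sublist_def using that
      by (intro exI[of _ us] exI[of _ "tl vs"]) simp
    moreover have "sublist ys (ys @ [hd vs])"
      by simp
    ultimately show False
      using max[of "ys @ [hd vs]"] ys assms(1) by (simp add: sorted_wrt_snoc_last)
  qed
  ultimately show "\<exists>us vs. xs = us @ ys @ vs \<and> chain_between R us ys vs"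
    using xs ys by (auto simp: chain_between_def)
next
  assume "\<exists>us vs. xs = us @ ys @ vs \<and> chain_between R us ys vs"
  then obtain us vs where xs: "xs = us @ ys @ vs" and ys: "ys \<noteq> []" "sorted_wrt R ys"
    and us: "us = [] \<or> \<not> R (last us) (hd ys)" and vs: "vs = [] \<or> \<not> R (last ys) (hd vs)"
    by (auto simp: chain_between_def)
  have "zs = ys" if zs: "sublist zs xs" "sorted_wrt R zs" "sublist ys zs" for zs
  proof -
    obtain us' vs' p q where *: "xs = us' @ zs @ vs'" "zs = p @ ys @ q"
      using zs(1,3) unfolding sublist_def by blast
    obtain y ys' where y: "ys = y # ys'"
      using ys(1) by (cases ys) auto
    \<comment> \<open>The first letter of \<open>ys\<close> occurs only once in \<open>xs\<close>,
      so both factorizations of \<open>xs\<close> are aligned at it.\<close>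
    have "us @ y # (ys' @ vs) = (us' @ p) @ y # (ys' @ q @ vs')"
      using * xs y by simp
    moreover have "y \<notin> set us" "y \<notin> set (ys' @ vs)"
      using assms(2) xs y by auto
    ultimately have "us = us' @ p \<and> ys' @ vs = ys' @ q @ vs'"
      using append_Cons_eq_iff[of y us "ys' @ vs" "us' @ p" "ys' @ q @ vs'"] by blast
    then have eq: "us = us' @ p" "vs = q @ vs'"
      by simp_all
    have "p = []"
    proof (rule ccontr)
      assume "p \<noteq> []"
      then have "R (last p) (hd ys)"
        using zs(2) *(2) ys(1) by (auto simp: sorted_wrt_append)
      with us eq \<open>p \<noteq> []\<close> show False by auto
    qed
    moreover have "q = []"
    proof (rule ccontr)
      assume "q \<noteq> []"
      then have "R (last ys) (hd q)"
        using zs(2) *(2) ys(1) by (auto simp: sorted_wrt_append)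
      with vs eq \<open>q \<noteq> []\<close> show False by auto
    qed
    ultimately show "zs = ys" using * by simp
  qed
  with xs ys show "ys \<in> maximal_chains R xs"
    by (auto simp: maximal_chains_def maximal_sublist_def)
qed

lemma first_chain_neq_Nil: "xs \<noteq> [] \<Longrightarrow> first_chain R xs \<noteq> []"
  by (cases "(R, xs)" rule: first_chain.cases) auto

lemma hd_first_chain: "xs \<noteq> [] \<Longrightarrow> hd (first_chain R xs) = hd xs"
  by (cases "(R, xs)" rule: first_chain.cases) auto

lemma chain_between_first_iff:
  assumes "transp R" "xs \<noteq> []"
  shows "(\<exists>vs. xs = ys @ vs \<and> chain_between R [] ys vs) \<longleftrightarrow> ys = first_chain R xs"
  using assms(2)
proof (induction xs arbitrary: ys rule: induct_list012)
  case (3 a b xs)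
  show ?case
  proof (cases "\<exists>y z zs. ys = y # z # zs")
    case False
    then have "ys = [] \<or> (\<exists>y. ys = [y])"
      by (metis neq_Nil_conv)
    then show ?thesis
      using first_chain_neq_Nil[of "b # xs" R] by (auto simp: chain_between_def)
  next
    case True
    then obtain y z zs where ys: "ys = y # z # zs" by blast
    have "a # b # xs = ys @ vs \<and> chain_between R [] ys vs \<longleftrightarrow>
        y = a \<and> R a b \<and> b # xs = (z # zs) @ vs \<and> chain_between R [] (z # zs) vs" for vs
      using sorted_wrt_Cons_hd[OF assms(1), of "z # zs" y]
      by (auto simp: ys chain_between_def simp del: sorted_wrt.simps)
    then have "(\<exists>vs. a # b # xs = ys @ vs \<and> chain_between R [] ys vs) \<longleftrightarrow>
        y = a \<and> R a b \<and> z # zs = first_chain R (b # xs)"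
      using "3.IH"(2)[of "z # zs"] by blast
    then show ?thesis
      by (auto simp: ys)
  qed
next
  case (2 x)
  show ?case
    by (cases ys) (auto simp: chain_between_def)
qed simp

text \<open>Prepending \<open>a\<close> affects only the first chain: if \<open>R a b\<close>, then
  \<open>a\<close> is joined to it, and otherwise \<open>[a]\<close> is a new chain.\<close>

lemma maximal_chains_Cons_Cons:
  fixes xs :: "'a list"
  assumes "transp R" "distinct (a # b # xs)"
  shows "maximal_chains R (a # b # xs) = insert (first_chain R (a # b # xs))
    (if R a b then maximal_chains R (b # xs) - {first_chain R (b # xs)}
     else maximal_chains R (b # xs))"
proof -
  \<comment> \<open>The chains of \<open>b # xs\<close> that do not start at its first
    letter.\<close>
  let ?later = "{ys. \<exists>u us vs. b # xs = (u # us) @ ys @ vs \<and> chain_between R (u # us) ys vs}"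
  have ex_list: "(\<exists>us. Q us) \<longleftrightarrow> Q [] \<or> (\<exists>u us. Q (u # us))" for Q :: "'a list \<Rightarrow> bool"
    by (metis neq_Nil_conv)
  have split: "maximal_chains R (x # zs) = insert (first_chain R (x # zs))
      {ys. \<exists>u us vs. x # zs = (u # us) @ ys @ vs \<and> chain_between R (u # us) ys vs}"
    if "distinct (x # zs)" for x zs
  proof -
    have "ys \<in> maximal_chains R (x # zs) \<longleftrightarrow> ys = first_chain R (x # zs) \<or>
        (\<exists>u us vs. x # zs = (u # us) @ ys @ vs \<and> chain_between R (u # us) ys vs)" for ys
      unfolding in_maximal_chains_iff[OF assms(1) that]
        chain_between_first_iff[OF assms(1) list.distinct(2), symmetric]
      by (subst ex_list) simp
    then show ?thesis
      by (intro set_eqI) (simp only: insert_iff mem_Collect_eq)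
  qed
  \<comment> \<open>Otherwise \<open>b\<close> would occur a second time. Hence deleting the first
    chain from the maximal chains leaves exactly \<open>?later\<close>.\<close>
  have notin: "first_chain R (b # xs) \<notin> ?later"
  proof clarify
    fix u us vs
    assume "b # xs = (u # us) @ first_chain R (b # xs) @ vs"
    then have "hd (first_chain R (b # xs)) \<in> set xs"
      using first_chain_neq_Nil[of "b # xs" R] by (cases "first_chain R (b # xs)") auto
    with assms(2) show False by (simp add: hd_first_chain)
  qed
  have "(\<exists>u us vs. a # b # xs = (u # us) @ ys @ vs \<and> chain_between R (u # us) ys vs) \<longleftrightarrow>
      (\<exists>vs. b # xs = ys @ vs \<and> chain_between R [] ys vs \<and> \<not> R a b) \<or> ys \<in> ?later" for ys
  proof -
    have "(\<exists>u us vs. a # b # xs = (u # us) @ ys @ vs \<and> chain_between R (u # us) ys vs) \<longleftrightarrow>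
        (\<exists>vs. b # xs = ys @ vs \<and> chain_between R [a] ys vs) \<or>
        (\<exists>u us vs. b # xs = (u # us) @ ys @ vs \<and> chain_between R (a # u # us) ys vs)"
      using ex_list[of "\<lambda>us. \<exists>vs. b # xs = us @ ys @ vs \<and> chain_between R (a # us) ys vs"] by simp
    moreover have "chain_between R [a] ys vs \<longleftrightarrow> chain_between R [] ys vs \<and> \<not> R a b"
      if "b # xs = ys @ vs" for vs
      using that by (cases ys) (auto simp: chain_between_def)
    moreover have "chain_between R (a # u # us) ys vs \<longleftrightarrow> chain_between R (u # us) ys vs" for u us vs
      by (simp add: chain_between_def)
    ultimately show ?thesis by blast
  qed
  then have later: "{ys. \<exists>u us vs. a # b # xs = (u # us) @ ys @ vs \<and> chain_between R (u # us) ys vs}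
      = (if R a b then ?later else insert (first_chain R (b # xs)) ?later)"
    using chain_between_first_iff[OF assms(1), of "b # xs"] by auto
  show ?thesis
    unfolding split[OF assms(2)] later using split[of b xs] assms(2) notin by auto
qed

lemma maximal_chains_singleton: "maximal_chains R [a] = {[a]}"
  by (auto simp: maximal_chains_def maximal_sublist_def sublist_Cons_right prefix_Cons)

lemma maximal_chains_Nil: "maximal_chains R [] = {}"
  by (auto simp: maximal_chains_def maximal_sublist_def)

lemma finite_maximal_chains: "finite (maximal_chains R xs)"
  by (rule finite_subset[OF _ finite_set[of "sublists xs"]])
     (auto simp: maximal_chains_def maximal_sublist_def)

definition long_chains :: "('a \<Rightarrow> 'a \<Rightarrow> bool) \<Rightarrow> 'a list \<Rightarrow> 'a list set" where
  "long_chains R xs = {ys \<in> maximal_chains R xs. 2 \<le> length ys}"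

lemma finite_long_chains: "finite (long_chains R xs)"
  by (simp add: long_chains_def finite_maximal_chains)

text \<open>A new long chain appears only when the first chain \<open>[b]\<close>, too short to be
  counted, grows to \<open>[a, b]\<close>. If also \<open>R b c\<close>, a chain already counted
  merely becomes longer.\<close>

lemma card_long_chains_Cons:
  assumes R: "transp R" and d: "distinct (a # b # c # xs)"
  shows "card (long_chains R (a # b # c # xs)) =
    card (long_chains R (b # c # xs)) + (if R a b \<and> \<not> R b c then 1 else 0)"
proof -
  let ?f = "first_chain R (b # c # xs)"
  have f: "?f \<in> maximal_chains R (b # c # xs)"
    using maximal_chains_Cons_Cons[OF R, of b c xs] d by simp
  have fresh: "a # ys \<notin> maximal_chains R (b # c # xs)" for ys
    using d by (auto simp: maximal_chains_def maximal_sublist_def dest!: set_mono_sublist)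
  have len: "2 \<le> length ?f \<longleftrightarrow> R b c"
    using first_chain_neq_Nil[of "c # xs" R] by (auto simp: Suc_le_eq)
  have len1: "1 \<le> length ?f"
    using first_chain_neq_Nil[of "b # c # xs" R] by (simp add: Suc_le_eq del: first_chain.simps)
  show ?thesis
  proof (cases "R a b")
    case False
    then have "long_chains R (a # b # c # xs) = long_chains R (b # c # xs)"
      using maximal_chains_Cons_Cons[OF R d] by (auto simp: long_chains_def simp del: first_chain.simps(1)) (simp_all)
    with False show ?thesis by simp
  next
    case True
    then have eq: "long_chains R (a # b # c # xs) = insert (a # ?f) (long_chains R (b # c # xs) - {?f})"
      using maximal_chains_Cons_Cons[OF R d] len1
      by (auto simp: long_chains_def first_chain.simps(1)[of R a] simp del: first_chain.simps)
    have "card (long_chains R (a # b # c # xs)) = Suc (card (long_chains R (b # c # xs) - {?f}))"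
      unfolding eq using fresh finite_long_chains[of R "b # c # xs"]
      by (subst card_insert_disjoint) (simp_all add: long_chains_def)
    moreover have "?f \<in> long_chains R (b # c # xs) \<longleftrightarrow> R b c"
      using f len by (simp add: long_chains_def del: first_chain.simps)
    ultimately show ?thesis
      using True card_Suc_Diff1[OF finite_long_chains, of ?f R "b # c # xs"]
      by (auto simp del: first_chain.simps)
  qed
qed

section \<open>Biruns and up-down runs as blocks\<close>

lemma biruns_eq: "biruns xs = long_chains (<) xs \<union> long_chains (>) xs"
  by (auto simp: biruns_def long_chains_def maximal_chains_def)

lemma increasing_runs_eq: "increasing_runs xs = maximal_chains (<) xs"
  by (simp add: increasing_runs_def maximal_chains_def)

text \<open>Induction on the list: for the two orders together, prepending \<open>a\<close> adds a
  birun exactly when the comparisons of \<open>a\<close>, \<open>b\<close> and of \<open>b\<close>,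
  \<open>c\<close> differ, that is, when a new block starts.\<close>

lemma br_eq_blocks: "distinct xs \<Longrightarrow> br xs = blocks (ascents xs)"
proof -
  have disj: "long_chains (<) ys \<inter> long_chains (>) ys = {}" for ys :: "nat list"
  proof -
    have "\<not> (sorted_wrt (<) zs \<and> sorted_wrt (>) zs)" if "2 \<le> length zs" for zs :: "nat list"
      using that by (cases zs rule: ascents.cases) auto
    then show ?thesis
      by (auto simp: long_chains_def maximal_chains_def maximal_sublist_def)
  qed
  have br: "br ys = card (long_chains (<) ys) + card (long_chains (>) ys)" for ys
    unfolding br_def biruns_eq by (intro card_Un_disjoint finite_long_chains disj)
  assume "distinct xs"
  then show ?thesis
  proof (induction xs rule: ascents.induct)
    case (1 a b xs)
    show ?case
    proof (cases xs)
      case Nil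
      have "long_chains R [a, b] = (if R a b then {[a, b]} else {})" if "transp R" for R :: "nat \<Rightarrow> nat \<Rightarrow> bool"
        using maximal_chains_Cons_Cons[OF that, of a b "[]"] 1
        by (auto simp: long_chains_def maximal_chains_singleton)
      with 1 Nil show ?thesis
        by (auto simp: br)
    next
      case (Cons c ys)
      with 1 show ?thesis
        using card_long_chains_Cons[of "(<)" a b c ys] card_long_chains_Cons[of "(>)" a b c ys]
        by (auto simp: br)
    qed
  qed (auto simp: br long_chains_def maximal_chains_singleton maximal_chains_Nil)
qed

text \<open>The prepended ascent is a block of its own exactly when the initial increasing run has
  length 1.\<close>

lemma udr_eq_blocks:
  assumes "distinct xs"
  shows "udr xs = blocks_left True xs"
proof (cases xs rule: ascents.cases)
  case (1 a b zs)
  have "{ys \<in> increasing_runs xs. prefix ys xs \<and> length ys = 1} = (if a < b then {} else {[a]})"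
  proof -
    have "{ys \<in> increasing_runs xs. prefix ys xs \<and> length ys = 1} = {ys \<in> maximal_chains (<) xs. ys = [a]}"
      by (auto simp: increasing_runs_eq 1 length_Suc_conv)
    also have "\<dots> = (if a < b then {} else {[a]})"
    proof -
      have "[a] \<notin> maximal_chains (<) (b # zs)"
        using assms 1 by (auto simp: maximal_chains_def maximal_sublist_def dest!: set_mono_sublist)
      then show ?thesis
        using maximal_chains_Cons_Cons[of "(<)" a b zs] assms 1 first_chain_neq_Nil[of "b # zs" "(<)"] by auto
    qed
    finally show ?thesis .
  qed
  then have "up_down_runs xs = biruns xs \<union> (if a < b then {} else {[a]})"
    by (simp add: up_down_runs_def)
  moreover have "finite (biruns xs)" "[a] \<notin> biruns xs"
    by (simp_all add: biruns_eq finite_long_chains) (simp add: long_chains_def)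
  ultimately have "udr xs = br xs + (if a < b then 0 else 1)"
    by (simp add: udr_def br_def)
  then show ?thesis
    using br_eq_blocks[OF assms] by (simp add: 1 blocks_left_def)
qed (auto simp: udr_def up_down_runs_def biruns_eq long_chains_def maximal_chains_singleton
    maximal_chains_Nil increasing_runs_eq blocks_left_def Collect_conv_if)

subsection \<open>The differential equations\<close>

text \<open>The equation determines each coefficient from the earlier ones. Below, \<open>f\<close>
  is the difference of the two sides of an identity to be proved.\<close>

lemma fps_linear_ode_unique:
  fixes f g :: "'a::field_char_0 fps"
  assumes "fps_deriv f = g * f" "fps_nth f 0 = 0"
  shows "f = 0"
proof -
  have "fps_nth f n = 0" for n
  proof (induction n rule: less_induct)
    case (less n)
    show ?case
    proof (cases n)
      case (Suc m)
      have "of_nat (Suc m) * fps_nth f (Suc m) = fps_nth (g * f) m"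
        by (simp flip: assms(1))
      also have "\<dots> = 0"
        using less Suc by (auto simp: fps_mult_nth intro!: sum.neutral)
      finally show ?thesis
        using Suc by (simp del: of_nat_Suc)
    qed (simp add: assms(2))
  qed
  then show ?thesis by (simp add: fps_ext)
qed

lemma fps_deriv_cosh [simp]: "fps_deriv (fps_cosh c) = fps_const c * fps_sinh c"
  by (simp add: fps_cosh_def fps_sinh_def algebra_simps flip: fps_const_neg)

lemma fps_deriv_sinh [simp]: "fps_deriv (fps_sinh c) = fps_const c * fps_cosh c"
  by (simp add: fps_cosh_def fps_sinh_def algebra_simps flip: fps_const_neg)

lemma fps_cosh_nth_0 [simp]: "fps_nth (fps_cosh c) 0 = 1"
  by (simp add: fps_cosh_def)

lemma fps_sinh_nth_0 [simp]: "fps_nth (fps_sinh c) 0 = 0"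
  by (simp add: fps_sinh_def)

lemma fps_cosh_sinh_square: "(fps_cosh c)\<^sup>2 - (fps_sinh c)\<^sup>2 = 1"
proof -
  have "fps_deriv ((fps_cosh c)\<^sup>2 - (fps_sinh c)\<^sup>2) = 0"
    by (simp add: power2_eq_square algebra_simps)
  then show ?thesis
    by (simp add: fps_deriv_eq_0_iff fps_nth_power_0 del: fps_deriv_sub)
qed

theorem theorem15:
  fixes t v :: "'a::field_char_0"
  assumes v_square: "v\<^sup>2 = 1 - t\<^sup>2"
    and v_nonzero: "v \<noteq> 0"
  shows "perm_egf br t =
      fps_const (v / (1 + t)\<^sup>2) *
      ((fps_const (2 * t)
          + (1 + fps_X + fps_const (t\<^sup>2) * (1 - fps_X)) * fps_cosh v
          - fps_const v * (1 + fps_X) * fps_sinh v)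
        / (fps_const v * fps_cosh v - fps_sinh v))
    \<and> perm_egf udr t =
      fps_const (v / (1 + t)) *
      ((fps_const t + fps_cosh v - fps_const v * fps_sinh v)
        / (fps_const v * fps_cosh v - fps_sinh v))"
proof -
  define B where "B = perm_egf (\<lambda>\<pi>. blocks (ascents \<pi>)) t"
  define U where "U = perm_egf (blocks_left True) t"
  define V where "V = perm_egf (blocks_both True True) t"
  define W where "W = perm_egf (blocks_both True False) t"
  \<comment> \<open>The two factors belong to \<open>blocks_right True\<close> and
    \<open>blocks_left False\<close>; by symmetry both equal \<open>U\<close>.\<close>
  have B': "fps_deriv B = U * U"
    using fps_deriv_perm_egf[OF order_invariant_blocks(2,1) blocks_insert_max(1)]
    by (simp add: B_def U_def perm_egf_blocks_rev perm_egf_blocks_complement(1)[of True, simplified])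
  have U': "fps_deriv U = V * U"
    using fps_deriv_perm_egf[OF order_invariant_blocks(3,1) blocks_insert_max(2)]
    by (simp add: V_def U_def perm_egf_blocks_complement(1)[of True, simplified])
  \<comment> \<open>The right factor comes from \<open>blocks_both False True\<close>, which the
    complement takes to \<open>W\<close>; for \<open>W'\<close> it comes from
    \<open>blocks_both False False\<close>, which becomes \<open>V\<close>.\<close>
  have V': "fps_deriv V = V * W"
    using fps_deriv_perm_egf[OF order_invariant_blocks(3,3) blocks_insert_max(3), of True t]
    by (simp add: V_def W_def perm_egf_blocks_complement(2)[of True False, simplified])
  have W': "fps_deriv W = V * V"
    using fps_deriv_perm_egf[OF order_invariant_blocks(3,3) blocks_insert_max(3), of False t]
    by (simp add: V_def W_def perm_egf_blocks_complement(2)[of True True, simplified])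
  have init: "fps_nth B 0 = 1" "fps_nth U 0 = 1" "fps_nth V 0 = t" "fps_nth W 0 = 1"
    by (simp_all add: B_def U_def V_def W_def perm_egf_nth_0 blocks_left_def blocks_both_def)

  define T where "T = fps_const t"
  define c where "c = fps_const v"
  define C where "C = fps_cosh v"
  define S where "S = fps_sinh v"
  \<comment> \<open>\<open>D\<close> is the common denominator; \<open>N\<close> and
    \<open>P\<close> are the numerators for \<open>udr\<close> and \<open>br\<close>. Writing them
    in \<open>T\<close> and \<open>c\<close> reduces later steps to polynomial identities.\<close>
  define D where "D = c * C - S"
  define N where "N = T + C - c * S"
  define P where "P = 2 * T + (1 + fps_X + T * T * (1 - fps_X)) * C - c * (1 + fps_X) * S"
  have deriv [simp]: "fps_deriv T = 0" "fps_deriv c = 0" "fps_deriv C = c * S" "fps_deriv S = c * C"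
    by (simp_all add: T_def c_def C_def S_def)
  have nth0: "fps_nth T 0 = t" "fps_nth c 0 = v" "fps_nth C 0 = 1" "fps_nth S 0 = 0"
    "fps_nth D 0 = v" "fps_nth N 0 = 1 + t" "fps_nth P 0 = (1 + t)\<^sup>2"
    by (simp_all add: T_def c_def C_def S_def D_def N_def P_def power2_eq_square algebra_simps)
  have D0: "D \<noteq> 0"
    using nth0(5) v_nonzero by auto
  have cc: "c * c = 1 - T * T"
    using v_square by (simp add: c_def T_def power2_eq_square fps_const_sub[symmetric] del: fps_const_sub)
  have CS: "C * C - S * S = 1"
    using fps_cosh_sinh_square[of v] by (simp add: C_def S_def power2_eq_square)

  have WV: "W * W - V * V = c * c"
  proof -
    have "fps_deriv (W * W - V * V) = 0"
      by (simp add: V' W' algebra_simps)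
    then have "W * W - V * V = fps_const (1 - t * t)"
      by (simp add: fps_deriv_eq_0_iff init del: fps_deriv_sub)
    then show ?thesis
      using v_square by (simp add: c_def power2_eq_square)
  qed
  have D': "fps_deriv D = c * c * S - c * C"
    by (simp add: D_def algebra_simps)
  have WD: "W * D = - fps_deriv D"
  proof -
    have "W * D + fps_deriv D = 0"
    \<comment> \<open>Here \<open>D'' = c * c * D\<close> meets the Riccati equation
      \<open>W' = W * W - c * c\<close>.\<close>
    proof (rule fps_linear_ode_unique)
      show "fps_deriv (W * D + fps_deriv D) = W * (W * D + fps_deriv D)"
        unfolding D' fps_deriv_add fps_deriv_mult W' using WV D_def
        by (simp add: D') algebra
    qed (simp add: D' nth0 init)
    then show ?thesis by (simp add: eq_neg_iff_add_eq_0)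
  qed
  have VD: "V * D = T * c"
  proof -
    have "fps_deriv (V * D) = 0"
      using WD by (simp add: V') algebra
    then show ?thesis
      by (simp add: fps_deriv_eq_0_iff init nth0 T_def c_def del: fps_deriv_mult)
  qed
  have N': "fps_deriv N = (V - W) * N"
  proof -
    \<comment> \<open>Multiplication by \<open>D\<close> makes \<open>V\<close> and \<open>W\<close>
      explicit through \<open>VD\<close> and \<open>WD\<close>. The equation obtained for
      \<open>N\<close> is the one that \<open>U * D\<close> satisfies.\<close>
    have "D * fps_deriv N = D * ((V - W) * N)"
      using VD WD D' cc CS by (simp add: N_def D_def) algebra
    then show ?thesis
      using D0 by simp
  qed
  have UD: "(1 + T) * (U * D) = c * N"
  proof -
    have "(1 + T) * (U * D) - c * N = 0"
    proof (rule fps_linear_ode_unique)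
      show "fps_deriv ((1 + T) * (U * D) - c * N) = (V - W) * ((1 + T) * (U * D) - c * N)"
        using WD by (simp add: U' N') algebra
    qed (simp add: init nth0)
    then show ?thesis by simp
  qed
  have BD: "(1 + T)\<^sup>2 * (B * D) = c * P"
  proof -
    \<comment> \<open>In quotient form, the derivative of \<open>P / D\<close> is
      \<open>c * N * N / (D * D)\<close>, which matches \<open>B' = U * U\<close> up to
      constants.\<close>
    have P': "fps_deriv P * D = P * fps_deriv D + c * N * N"
      unfolding D' using cc CS by (simp add: P_def D_def N_def) algebra
    have "(1 + T)\<^sup>2 * (B * D) - c * P = 0"
    proof (rule fps_linear_ode_unique)
      have "D * fps_deriv ((1 + T)\<^sup>2 * (B * D) - c * P)
          = D * (- W * ((1 + T)\<^sup>2 * (B * D) - c * P))"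
        using WD UD P' by (simp add: B' power2_eq_square) algebra
      then show "fps_deriv ((1 + T)\<^sup>2 * (B * D) - c * P) = - W * ((1 + T)\<^sup>2 * (B * D) - c * P)"
        using D0 by (simp only: mult_cancel_left simp_thms)
    qed (simp add: init nth0 power2_eq_square)
    then show ?thesis by simp
  qed

  \<comment> \<open>If \<open>t = -1\<close>, then \<open>v\<^sup>2 = 0\<close>.\<close>
  have t1: "1 + t \<noteq> 0"
    using v_square v_nonzero by (auto simp: add_eq_0_iff)
  \<comment> \<open>Division by \<open>D\<close> is legitimate because its constant coefficient
    \<open>v\<close> is nonzero, so \<open>D\<close> is a unit.\<close>
  have solve: "F = fps_const (v / k) * (Q / D)" if "fps_const k * (F * D) = c * Q" "k \<noteq> 0" for F Q k
  proof -
    define K where "K = fps_const k"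
    define E where "E = fps_const (v / k)"
    have "K \<noteq> 0" and KE: "K * E = c"
      using that(2) by (simp_all add: K_def E_def c_def)
    have QD: "Q / D * D = Q"
    proof -
      have "inverse D * D = 1"
        using nth0(5) v_nonzero by (intro inverse_mult_eq_1) simp
      then show ?thesis
        using nth0(5) v_nonzero by (simp add: fps_divide_unit mult.assoc)
    qed
    have "(K * D) * F = (K * D) * (E * (Q / D))"
      using that(1) KE QD unfolding K_def[symmetric] by algebra
    then show ?thesis
      using D0 \<open>K \<noteq> 0\<close> unfolding E_def by (simp only: mult_cancel_left mult_eq_0_iff simp_thms)
  qed
  have const: "fps_const (1 + t) = 1 + T" "fps_const (2 * t) = 2 * T"
    by (simp_all only: T_def mult_2 fps_const_add flip: fps_const_1_eq_1)
  have const_sq: "fps_const (t\<^sup>2) = T * T"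
    by (simp add: T_def power2_eq_square)
  have "perm_egf br t = B"
    unfolding B_def by (rule perm_egf_cong) (rule br_eq_blocks)
  moreover have "B = fps_const (v / (1 + t)\<^sup>2) * (P / D)"
    using BD t1 by (intro solve) (simp_all add: const flip: fps_const_power)
  moreover have "perm_egf udr t = U"
    unfolding U_def by (rule perm_egf_cong) (rule udr_eq_blocks)
  moreover have "U = fps_const (v / (1 + t)) * (N / D)"
    using UD t1 by (intro solve) (simp_all add: const)
  moreover have "P = fps_const (2 * t) + (1 + fps_X + fps_const (t\<^sup>2) * (1 - fps_X)) * C
      - fps_const v * (1 + fps_X) * S"
    by (simp only: P_def c_def const const_sq)
  ultimately show ?thesis
    by (simp only: N_def D_def T_def c_def C_def S_def simp_thms)
qed

end
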